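(* Let $n\ge 1$ and $\delta\in(0,1/2)$. Suppose that $(X,Y),(X_1,Y_1),\dots,(X_n,Y_n)$ are i.i.d., that the noise $\varepsilon=Y-g(X)$ is sub-Gaussian conditionally on $X$ with parameter $\sigma^2$, and that $g$ is $L$-Lipschitz on $S_X$. Suppose that the local map $\mathcal V$ (possibly random and depending on the sample) is VC with dimension $v$. Then, with probability at least $1-2\delta$, for all $x\in S_X$, $$|\hat g_{\mathcal V}(x)-g(x)|\le \sqrt{\frac{2\sigma^2\log\left(\frac{(n+1)^v}{\delta}\right)}{nP_n^X(\mathcal V(x))}}+L(\mathcal V(x))\,\mathrm{diam}(\mathcal V(x)).$$
   Context: Setting: $d\ge1$; $(X,Y)$ is a random vector with law $P$ on $\mathbb R^d\times\mathbb R$, $X$ takes values in $S_X\subset\mathbb R^d$, $g(x)=\mathbb E[Y\mid X=x]$ for $x\in S_X$, $\varepsilon=Y-g(X)$. Sub-Gaussian conditionally on $X$ with parameter $\sigma^2$: $\mathbb E[\varepsilon\mid X]=0$ and $\mathbb E[\exp(t\varepsilon)\mid X]\le\exp(t^2\sigma^2/2)$ a.s. for all $t\in\mathbb R$. $g$ is $L$-Lipschitz on $S_X$: $|g(x)-g(y)|\le L\|x-y\|_2$ for all $x,y\in S_X$. For $V\subset S_X$, $L(V)$ is the smallest constant such that $|g(x)-g(y)|\le L(V)\|x-y\|_2$ for all $x,y\in V$. $\mathrm{diam}(V)=\sup_{x,y\in V}\|x-y\|_2$. A local map is a mapping $\mathcal V:S_X\to\mathcal B(S_X)$ (Borel subsets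 of $S_X$) with $x\in\mathcal V(x)$ for all $x\in S_X$, and every $\mathcal V(x)$ has positive Lebesgue measure. It may be random and depend on $(X_i,Y_i)_{i\le n}$. The associated estimator is $$\hat g_{\mathcal V}(x)=\frac{\sum_{i=1}^nY_i\mathbf 1_{\mathcal V(x)}(X_i)}{\sum_{i=1}^n\mathbf 1_{\mathcal V(x)}(X_i)},\qquad 0/0=0.$$ $nP_n^X(A)=\sum_{i=1}^n\mathbf 1_A(X_i)$. The bound is read as $+\infty$ when $P_n^X(\mathcal V(x))=0$. $\mathcal V$ is VC with dimension $v$ if there is a fixed (deterministic) collection $\mathcal A$ of subsets of $\mathbb R^d$ of finite Vapnik–Chervonenkis dimension $v$ with $\{\mathcal V(x):x\in S_X\}\subset\mathcal A$. The VC dimension is the largest $k\ge1$ such that some $k$ distinct points are shattered by $\mathcal A$.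
   Formalization: The VC collection 𝒜 is also assumed measurable: for each index set I, the samples (X_1,…,X_n) from which some member of 𝒜 picks exactly the points indexed by I form a set measurable for the completed product law; without this the claim fails for pathological 𝒜. *)

theory Defs
  imports "HOL-Probability.Probability"
begin

definition iid_sample :: "'w measure \<Rightarrow> (nat \<Rightarrow> 'w \<Rightarrow> 'a::euclidean_space) \<Rightarrow> (nat \<Rightarrow> 'w \<Rightarrow> real) \<Rightarrow> nat \<Rightarrow> bool"
  where \<comment> \<open>Index 0 is the generic pair \<open>(X, Y)\<close>; indices 1 to n are the observations.\<close>
  "iid_sample M X Y n \<longleftrightarrow>
     prob_space M \<and>
     prob_space.indep_vars M (\<lambda>_. borel \<Otimes>\<^sub>M borel) (\<lambda>i \<omega>. (X i \<omega>, Y i \<omega>)) {0..n} \<and>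
     (\<forall>i\<in>{0..n}. distr M (borel \<Otimes>\<^sub>M borel) (\<lambda>\<omega>. (X i \<omega>, Y i \<omega>))
               = distr M (borel \<Otimes>\<^sub>M borel) (\<lambda>\<omega>. (X 0 \<omega>, Y 0 \<omega>)))"

definition sigma_gen :: "'w measure \<Rightarrow> ('w \<Rightarrow> 'a::topological_space) \<Rightarrow> 'w measure" where
  "sigma_gen M X = vimage_algebra (space M) X borel"

definition regression_function ::
    "'w measure \<Rightarrow> ('w \<Rightarrow> 'a::euclidean_space) \<Rightarrow> ('w \<Rightarrow> real) \<Rightarrow> 'a set \<Rightarrow> ('a \<Rightarrow> real) \<Rightarrow> bool" where
  "regression_function M X Y S g \<longleftrightarrow>
     integrable M Y \<and>
     g \<in> borel_measurable (restrict_space borel S) \<and>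
     (AE \<omega> in M. real_cond_exp M (sigma_gen M X) Y \<omega> = g (X \<omega>))"

text \<open>The conditional exponential moment is taken in \<open>[0, \<infinity>]\<close>: \<open>real_cond_exp\<close> would be
  meaningless (and the bound possibly vacuous) where that moment is infinite.\<close>

definition cond_subgaussian :: "'w measure \<Rightarrow> 'w measure \<Rightarrow> ('w \<Rightarrow> real) \<Rightarrow> real \<Rightarrow> bool" where
  "cond_subgaussian M F \<epsilon> s2 \<longleftrightarrow>
     integrable M \<epsilon> \<and>
     (AE \<omega> in M. real_cond_exp M F \<epsilon> \<omega> = 0) \<and>
     (\<forall>t::real. AE \<omega> in M.
        nn_cond_exp M F (\<lambda>\<omega>. ennreal (exp (t * \<epsilon> \<omega>))) \<omega> \<le> ennreal (exp (t\<^sup>2 * s2 / 2)))"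

definition local_lipschitz_const :: "('a::metric_space \<Rightarrow> real) \<Rightarrow> 'a set \<Rightarrow> ereal" where
  "local_lipschitz_const g V = (INF c\<in>{c. lipschitz_on c V g}. ereal c)"

text \<open>Extended-real valued, because \<open>diameter\<close> is real valued and hence unspecified on
  unbounded sets.\<close>

definition ediam :: "'a::metric_space set \<Rightarrow> ereal" where
  "ediam V = (SUP x\<in>V. SUP y\<in>V. ereal (dist x y))"

text \<open>\<open>S\<close> need not be Borel: the Borel subsets of \<open>S\<close> are those of the subspace \<open>S\<close>.\<close>

definition local_map :: "'a::euclidean_space set \<Rightarrow> ('a \<Rightarrow> 'a set) \<Rightarrow> bool" where
  "local_map S V \<longleftrightarrow>
     (\<forall>x\<in>S. x \<in> V x \<and> V x \<in> sets (restrict_space borel S) \<and> emeasure lebesgue (V x) > 0)"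

text \<open>\<open>local_count n xs A\<close> is $n P_n^X(A)$. In \<open>local_average\<close> the convention $0/0 = 0$ is that
  of HOL division.\<close>

definition local_count :: "nat \<Rightarrow> (nat \<Rightarrow> 'a) \<Rightarrow> 'a set \<Rightarrow> real" where
  "local_count n xs A = (\<Sum>i=1..n. indicator A (xs i))"

definition local_average :: "nat \<Rightarrow> (nat \<Rightarrow> 'a) \<Rightarrow> (nat \<Rightarrow> real) \<Rightarrow> ('a \<Rightarrow> 'a set) \<Rightarrow> 'a \<Rightarrow> real" where
  "local_average n xs ys V x =
     (\<Sum>i=1..n. ys i * indicator (V x) (xs i)) / (\<Sum>i=1..n. indicator (V x) (xs i))"

definition shatters :: "'a set set \<Rightarrow> 'a set \<Rightarrow> bool" where
  "shatters \<A> F \<longleftrightarrow> (\<lambda>A. A \<inter> F) ` \<A> = Pow F"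

definition has_vc_dim :: "'a set set \<Rightarrow> nat \<Rightarrow> bool" where
  "has_vc_dim \<A> v \<longleftrightarrow>
     1 \<le> v \<and> (\<exists>F. finite F \<and> card F = v \<and> shatters \<A> F) \<and>
     (\<forall>F. finite F \<and> shatters \<A> F \<longrightarrow> card F \<le> v)"

text \<open>
  Measurability of a class of sets, in the spirit of the ``measurable classes'' of empirical
  process theory: for every index set \<open>I\<close>, the samples out of which some member of the class picks
  exactly the points with index in \<open>I\<close> form a measurable set for the completion of the n-fold
  product of \<open>\<mu>\<close>. Every countable class of Borel sets has this property. Without it, uniform
  deviation bounds over a class of finite VC dimension can fail: under the continuum hypothesis,
  the countable initial segments of a well-ordering of the unit interval of type $\omega_1$ form
  a chain, hence have VC dimension 1, yet the samples that are enumerated by the well-ordering in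
  any prescribed order of their indices have full outer measure, so that any index set may be picked out.\<close>

definition pattern_measurable :: "'a measure \<Rightarrow> nat \<Rightarrow> 'a set set \<Rightarrow> bool" where
  "pattern_measurable \<mu> n \<A> \<longleftrightarrow>
     (\<forall>I\<subseteq>{1..n}. {xs \<in> {1..n} \<rightarrow>\<^sub>E space \<mu>. \<exists>A\<in>\<A>. \<forall>i\<in>{1..n}. xs i \<in> A \<longleftrightarrow> i \<in> I}
        \<in> sets (completion (\<Pi>\<^sub>M i\<in>{1..n}. \<mu>)))"

text \<open>In the product of the local Lipschitz constant and the diameter, \<open>ereal\<close> gives
  $0 \cdot \infty = 0$: if \<open>g\<close> is constant on an unbounded \<open>V\<close>, the second term vanishes.\<close>

definition error_bound ::
    "nat \<Rightarrow> (nat \<Rightarrow> 'a::metric_space) \<Rightarrow> real \<Rightarrow> nat \<Rightarrow> real \<Rightarrow> ('a \<Rightarrow> real) \<Rightarrow> 'a set \<Rightarrow> ereal" where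
  "error_bound n xs \<sigma> v \<delta> g V =
     (if local_count n xs V = 0 then \<infinity>
      else ereal (sqrt (2 * \<sigma>\<^sup>2 * ln ((real n + 1) ^ v / \<delta>) / local_count n xs V))
           + local_lipschitz_const g V * ediam V)"

end

theory Submission
  imports Defs
begin

text \<open>
  On the samples where \<open>\<V>(x)\<close> selects exactly the indices \<open>I\<close>, the error splits into a bias, at
  most \<open>L(\<V>(x)) diam(\<V>(x))\<close>, and the noise average \<open>(\<Sum>i\<in>I. \<epsilon> i) / card I\<close>. The sum over a fixed
  \<open>I\<close> is sub-Gaussian given \<open>X 1, \<dots>, X n\<close>, so it exceeds \<open>sqrt (2 \<sigma>\<^sup>2 (card I) \<Lambda>)\<close> with conditional
  probability at most \<open>2 exp (- \<Lambda>)\<close>. The dependence of \<open>\<V>\<close> on the sample is harmless: given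
  \<open>X 1, \<dots>, X n\<close>, only the index sets picked out by \<open>\<A>\<close> matter, and there are at most \<open>(n + 1) ^ v\<close>
  of them by the Sauer--Shelah lemma. A union bound with \<open>\<Lambda> = ln ((n + 1) ^ v / \<delta>)\<close> gives the
  failure probability \<open>2 \<delta>\<close>. Weighting each index set by the probability that it is picked out
  turns conditioning on \<open>X 1, \<dots>, X n\<close> into Fubini's theorem on the product space.
\<close>

section \<open>The Sauer--Shelah lemma\<close>

lemma shatters_iff: "shatters \<A> F \<longleftrightarrow> (\<forall>C\<subseteq>F. \<exists>A\<in>\<A>. A \<inter> F = C)"
proof -
  have "(\<lambda>A. A \<inter> F) ` \<A> \<subseteq> Pow F" by auto
  then have "shatters \<A> F \<longleftrightarrow> Pow F \<subseteq> (\<lambda>A. A \<inter> F) ` \<A>"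
    unfolding shatters_def by (simp only: set_eq_subset simp_thms)
  also have "\<dots> \<longleftrightarrow> (\<forall>C\<in>Pow F. \<exists>A\<in>\<A>. C = A \<inter> F)"
    by (simp only: subset_eq image_iff)
  finally show ?thesis by (simp only: Ball_def Pow_iff eq_commute)
qed

text \<open>Pajor's strengthening of Sauer--Shelah, which has the advantage of a direct induction on
  \<open>U\<close>. Removing \<open>x\<close> splits \<open>\<F>\<close> into the members without
  \<open>x\<close> (\<open>F0\<close>) and the members with \<open>x\<close>, stripped of it
  (\<open>F1\<close>), and each half shatters at least as many subsets of \<open>U\<close> as it has
  members.\<close>

lemma card_le_card_shattered:
  assumes "finite U" and "\<F> \<subseteq> Pow U"
  shows "card \<F> \<le> card {B. B \<subseteq> U \<and> shatters \<F> B}"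
  using assms
proof (induction U arbitrary: \<F> rule: finite_induct)
  case empty
  show ?case
  proof (cases "\<F> = {}")
    case False
    with empty have "\<F> = {{}}" by auto
    then have "{B. B \<subseteq> {} \<and> shatters \<F> B} = {{}}" by (auto simp: shatters_iff)
    with \<open>\<F> = {{}}\<close> show ?thesis by simp
  qed simp
next
  case (insert x U)
  define F0 where "F0 = {A \<in> \<F>. x \<notin> A}"
  define F1 where "F1 = {A. x \<notin> A \<and> insert x A \<in> \<F>}"
  define S0 where "S0 = {B. B \<subseteq> U \<and> shatters F0 B}"
  define S1 where "S1 = {B. B \<subseteq> U \<and> shatters F1 B}"
  have sub: "F0 \<subseteq> Pow U" "F1 \<subseteq> Pow U" using insert.prems unfolding F0_def F1_def by auto
  have fin: "finite F0" "finite F1" "finite S0" "finite S1"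
    using sub insert.hyps(1) by (auto simp: S0_def S1_def intro: finite_subset[of _ "Pow U"])
  have inj: "inj_on (insert x) T" if "\<And>A. A \<in> T \<Longrightarrow> x \<notin> A" for T
    using that by (meson inj_onI insert_ident)
  have "\<F> = F0 \<union> insert x ` F1"
  proof
    show "\<F> \<subseteq> F0 \<union> insert x ` F1"
    proof
      fix A assume "A \<in> \<F>"
      then show "A \<in> F0 \<union> insert x ` F1"
        by (cases "x \<in> A") (auto simp: F0_def F1_def insert_absorb intro!: image_eqI[of _ _ "A - {x}"])
    qed
  qed (auto simp: F0_def F1_def)
  moreover have "F0 \<inter> insert x ` F1 = {}" by (auto simp: F0_def)
  moreover have "card (insert x ` F1) = card F1"
    by (rule card_image) (auto intro!: inj simp: F1_def)
  ultimately have "card \<F> = card F0 + card F1"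
    using fin by (metis card_Un_disjoint finite_imageI)
  also have "\<dots> \<le> card S0 + card S1"
    using insert.IH[OF sub(1)] insert.IH[OF sub(2)] by (simp add: S0_def S1_def add_mono)
  \<comment> \<open>A set shattered by both halves is counted twice on the left. It pays for this by
    yielding two shattered sets of \<open>\<F>\<close>: \<open>B\<close> itself and
    \<open>insert x B\<close>, where \<open>F1\<close> realises the traces containing
    \<open>x\<close> and \<open>F0\<close> the others.\<close>
  also have "\<dots> = card (S0 \<union> S1) + card (S0 \<inter> S1)"
    using fin by (intro card_Un_Int)
  also have "card (S0 \<inter> S1) = card (insert x ` (S0 \<inter> S1))"
    using insert.hyps(2) by (intro card_image[symmetric] inj) (auto simp: S0_def)
  also have "card (S0 \<union> S1) + card (insert x ` (S0 \<inter> S1)) = card (S0 \<union> S1 \<union> insert x ` (S0 \<inter> S1))"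
  proof (rule card_Un_disjoint[symmetric])
    show "(S0 \<union> S1) \<inter> insert x ` (S0 \<inter> S1) = {}"
      using insert.hyps(2) by (auto simp: S0_def S1_def)
  qed (use fin in auto)
  also have "\<dots> \<le> card {B. B \<subseteq> insert x U \<and> shatters \<F> B}"
  proof (rule card_mono)
    show "finite {B. B \<subseteq> insert x U \<and> shatters \<F> B}"
      using insert.hyps(1) by (auto intro: finite_subset[of _ "Pow (insert x U)"])
    have "shatters \<F> B" if "B \<in> S0" for B
      using that unfolding S0_def F0_def shatters_iff by blast
    moreover have "shatters \<F> B" if B: "B \<in> S1" for B
      unfolding shatters_iff
    proof (intro allI impI)
      fix C assume "C \<subseteq> B"
      then obtain A where "A \<in> F1" "A \<inter> B = C" using B unfolding S1_def shatters_iff by blast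
      moreover have "x \<notin> B" using B insert.hyps(2) by (auto simp: S1_def)
      ultimately show "\<exists>A\<in>\<F>. A \<inter> B = C"
        by (intro bexI[of _ "insert x A"]) (auto simp: F1_def)
    qed
    moreover have "shatters \<F> (insert x B)" if B: "B \<in> S0" "B \<in> S1" for B
      unfolding shatters_iff
    proof (intro allI impI)
      fix C assume C: "C \<subseteq> insert x B"
      have "x \<notin> B" using B insert.hyps(2) by (auto simp: S1_def)
      show "\<exists>A\<in>\<F>. A \<inter> insert x B = C"
      proof (cases "x \<in> C")
        case True
        have "C - {x} \<subseteq> B" using C by auto
        then obtain A where "A \<in> F1" "A \<inter> B = C - {x}" using B unfolding S1_def shatters_iff by blast
        then show ?thesis using True
          by (intro bexI[of _ "insert x A"]) (auto simp: F1_def)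
      next
        case False
        then have "C \<subseteq> B" using C by auto
        then obtain A where "A \<in> F0" "A \<inter> B = C" using B unfolding S0_def shatters_iff by blast
        then show ?thesis by (intro bexI[of _ A]) (auto simp: F0_def)
      qed
    qed
    ultimately show "S0 \<union> S1 \<union> insert x ` (S0 \<inter> S1) \<subseteq> {B. B \<subseteq> insert x U \<and> shatters \<F> B}"
      by (auto simp: S0_def S1_def)
  qed
  finally show ?case .
qed

text \<open>A crude bound valid for all \<open>m\<close> and \<open>d\<close>: the new term is at
  most \<open>m * (m + 1) ^ d\<close>, so each step multiplies the bound by \<open>m + 1\<close>. It
  is the source of the factor \<open>(n + 1) ^ v\<close>.\<close>

lemma sum_choose_le_power: "(\<Sum>i\<le>d. m choose i) \<le> (m + 1) ^ d"
proof (induction d)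
  case (Suc d)
  have "m choose Suc d \<le> m ^ Suc d"
  proof (cases "Suc d \<le> m")
    case True
    then show ?thesis by (rule binomial_le_pow)
  next
    case False
    then have "m choose Suc d = 0" by (intro binomial_eq_0) linarith
    then show ?thesis by (simp only: le0)
  qed
  also have "m ^ Suc d \<le> m * (m + 1) ^ d"
    unfolding power_Suc by (intro mult_le_mono2 power_mono) linarith+
  finally have "(\<Sum>i\<le>Suc d. m choose i) \<le> (m + 1) ^ d + m * (m + 1) ^ d"
    using Suc unfolding sum.atMost_Suc by (rule add_mono[rotated])
  also have "\<dots> = (m + 1) ^ Suc d"
    unfolding power_Suc distrib_right by (simp only: mult_1 add.commute)
  finally show ?case .
qed simp

text \<open>A subset of \<open>U\<close> shattered by the trace on \<open>U\<close> is shattered by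
  \<open>\<A>\<close> itself, so Pajor's count runs only over subsets of \<open>U\<close> with at
  most \<open>d\<close> points.\<close>

lemma sauer_shelah:
  assumes "finite U" and dim: "\<And>F. F \<subseteq> U \<Longrightarrow> shatters \<A> F \<Longrightarrow> card F \<le> d"
  shows "card ((\<lambda>A. A \<inter> U) ` \<A>) \<le> (card U + 1) ^ d"
proof -
  let ?T = "(\<lambda>A. A \<inter> U) ` \<A>"
  have "card ?T \<le> card {B. B \<subseteq> U \<and> shatters ?T B}"
    using assms(1) by (intro card_le_card_shattered) auto
  also have "\<dots> \<le> card (\<Union>i\<in>{..d}. {B. B \<subseteq> U \<and> card B = i})"
  proof (rule card_mono)
    have "shatters \<A> B" if "B \<subseteq> U" "shatters ?T B" for B
    proof -
      have "A \<inter> U \<inter> B = A \<inter> B" for A using that(1) by auto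
      with that(2) show ?thesis by (simp add: shatters_iff)
    qed
    with dim show "{B. B \<subseteq> U \<and> shatters ?T B} \<subseteq> (\<Union>i\<in>{..d}. {B. B \<subseteq> U \<and> card B = i})"
      by auto
  qed (use assms(1) in auto)
  also have "\<dots> \<le> (\<Sum>i\<le>d. card {B. B \<subseteq> U \<and> card B = i})"
    by (rule card_UN_le) simp
  also have "\<dots> = (\<Sum>i\<le>d. card U choose i)"
    using assms(1) by (simp add: n_subsets)
  also have "\<dots> \<le> (card U + 1) ^ d"
    by (rule sum_choose_le_power)
  finally show ?thesis .
qed

text \<open>An index pattern is determined by the trace of \<open>A\<close> on the set of sample
  points. Ties among the points therefore only reduce the number of patterns, and the image has at
  most \<open>n\<close> elements.\<close>

lemma card_index_patterns_le:
  fixes xs :: "nat \<Rightarrow> 'a"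
  assumes "has_vc_dim \<A> v"
  shows "card {I. I \<subseteq> {1..n} \<and> (\<exists>A\<in>\<A>. \<forall>i\<in>{1..n}. xs i \<in> A \<longleftrightarrow> i \<in> I)} \<le> (n + 1) ^ v"
    (is "card ?P \<le> _")
proof -
  let ?U = "xs ` {1..n}"
  let ?T = "(\<lambda>A. A \<inter> ?U) ` \<A>"
  have "?P \<subseteq> (\<lambda>A. {i\<in>{1..n}. xs i \<in> A}) ` ?T"
  proof
    fix I assume "I \<in> ?P"
    then obtain A where "A \<in> \<A>" and "I = {i\<in>{1..n}. xs i \<in> A}" by blast
    then have "I = {i\<in>{1..n}. xs i \<in> A \<inter> ?U}" "A \<inter> ?U \<in> ?T" by auto
    then show "I \<in> (\<lambda>A. {i\<in>{1..n}. xs i \<in> A}) ` ?T" by (rule image_eqI)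
  qed
  moreover have "finite ?T" by (rule finite_subset[of _ "Pow ?U"]) auto
  ultimately have "card ?P \<le> card ?T"
    by (meson card_image_le card_mono finite_imageI order_trans)
  also have "\<dots> \<le> (card ?U + 1) ^ v"
  proof (rule sauer_shelah)
    show "card F \<le> v" if "F \<subseteq> ?U" "shatters \<A> F" for F
      using that assms finite_subset[OF that(1)] unfolding has_vc_dim_def by blast
  qed simp
  also have "\<dots> \<le> (n + 1) ^ v"
    using card_image_le[of "{1..n}" xs] by (intro power_mono) auto
  finally show ?thesis .
qed

section \<open>Error of a local average for a fixed sample\<close>

lemma local_lipschitz_const_nonneg: "0 \<le> local_lipschitz_const g V"
  unfolding local_lipschitz_const_def by (auto intro!: INF_greatest simp: lipschitz_on_def)

text \<open>The infimum of the Lipschitz constants is itself a Lipschitz constant. Lipschitz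
  continuity on \<open>V\<close> makes it an infimum over a nonempty set of nonnegative reals, hence
  finite.\<close>

lemma abs_diff_le_local_lipschitz_const:
  assumes "lipschitz_on L V g" "x \<in> V" "y \<in> V"
  shows "ereal \<bar>g x - g y\<bar> \<le> local_lipschitz_const g V * ediam V"
proof -
  let ?C = "{c. lipschitz_on c V g}"
  have ne: "?C \<noteq> {}" using assms(1) by auto
  have bdd: "bdd_below ?C" by (rule bdd_belowI[of _ 0]) (simp add: lipschitz_on_def)
  have "ereal (Inf ?C) = local_lipschitz_const g V"
    unfolding local_lipschitz_const_def using ne bdd by (subst ereal_Inf') auto
  have "\<bar>g x - g y\<bar> \<le> Inf ?C * dist x y"
  proof (cases "dist x y = 0")
    case False
    then have "\<bar>g x - g y\<bar> / dist x y \<le> c" if "lipschitz_on c V g" for c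
      using lipschitz_onD[OF that assms(2,3)] by (simp add: dist_real_def divide_le_eq)
    then have "\<bar>g x - g y\<bar> / dist x y \<le> Inf ?C"
      using ne by (intro cInf_greatest) auto
    with False show ?thesis by (simp add: divide_le_eq)
  qed simp
  then have "ereal \<bar>g x - g y\<bar> \<le> ereal (Inf ?C) * ereal (dist x y)"
    by simp
  also have "\<dots> = local_lipschitz_const g V * ereal (dist x y)"
    by (simp add: \<open>ereal (Inf ?C) = _\<close>)
  \<comment> \<open>Multiplication by a nonnegative factor is monotone in \<open>ereal\<close>, also
    when \<open>ediam V\<close> is infinite and the factor is zero.\<close>
  also have "\<dots> \<le> local_lipschitz_const g V * ediam V"
    unfolding ediam_def using assms(2,3)
    by (intro ereal_mult_left_mono local_lipschitz_const_nonneg SUP_upper2[of x] SUP_upper2[of y]) auto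
  finally show ?thesis .
qed

lemma local_average_error_le:
  fixes g :: "'a::metric_space \<Rightarrow> real"
  assumes lip: "lipschitz_on L (V x) g" and "x \<in> V x"
    and noise: "\<bar>\<Sum>i\<in>{i\<in>{1..n}. xs i \<in> V x}. ys i - g (xs i)\<bar>
      \<le> sqrt (2 * \<sigma>\<^sup>2 * real (card {i\<in>{1..n}. xs i \<in> V x}) * ln ((real n + 1) ^ v / \<delta>))"
  shows "ereal \<bar>local_average n xs ys V x - g x\<bar> \<le> error_bound n xs \<sigma> v \<delta> g (V x)"
proof -
  define I where "I = {i\<in>{1..n}. xs i \<in> V x}"
  define m where "m = real (card I)"
  define \<Lambda> where "\<Lambda> = ln ((real n + 1) ^ v / \<delta>)"
  define K where "K = local_lipschitz_const g (V x) * ediam (V x)"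
  have restr: "(\<Sum>i=1..n. f i * indicator (V x) (xs i)) = sum f I" for f :: "nat \<Rightarrow> real"
    unfolding I_def sum.inter_filter[OF finite_atLeastAtMost]
    by (intro sum.cong) (auto simp: indicator_def)
  have cnt: "local_count n xs (V x) = m"
    using restr[of "\<lambda>_. 1"] by (simp add: local_count_def m_def)
  have avg: "local_average n xs ys V x = sum ys I / m"
    using restr[of ys] cnt by (simp add: local_average_def local_count_def)
  show ?thesis
  proof (cases "m = 0")
    \<comment> \<open>With no observation in the cell the bound is infinite, so the value given to
      \<open>0 / 0\<close> does not matter here.\<close>
    case True
    then show ?thesis by (simp add: error_bound_def cnt)
  next
    case False
    then have m: "m > 0" by (simp add: m_def)
    \<comment> \<open>Since \<open>m\<close> is the cardinality of \<open>I\<close>, the number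
      \<open>g x\<close> is the average of the constant \<open>g x\<close> over \<open>I\<close>;
      inserting \<open>g (xs i)\<close> separates noise from bias.\<close>
    have "local_average n xs ys V x - g x
        = (\<Sum>i\<in>I. ys i - g (xs i)) / m + (\<Sum>i\<in>I. g (xs i) - g x) / m"
      using m by (simp add: avg sum_subtractf add_divide_distrib[symmetric] field_simps m_def)
    then have split: "\<bar>local_average n xs ys V x - g x\<bar>
        \<le> \<bar>\<Sum>i\<in>I. ys i - g (xs i)\<bar> / m + \<bar>\<Sum>i\<in>I. g (xs i) - g x\<bar> / m"
      using m by (simp only: abs_divide abs_of_pos order_trans[OF abs_triangle_ineq])
    have variance: "\<bar>\<Sum>i\<in>I. ys i - g (xs i)\<bar> / m \<le> sqrt (2 * \<sigma>\<^sup>2 * \<Lambda> / m)"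
    proof -
      have "\<bar>\<Sum>i\<in>I. ys i - g (xs i)\<bar> / m \<le> sqrt (2 * \<sigma>\<^sup>2 * m * \<Lambda>) / m"
        using noise m unfolding I_def[symmetric] m_def[symmetric] \<Lambda>_def[symmetric]
        by (intro divide_right_mono) auto
      also have "\<dots> = sqrt (2 * \<sigma>\<^sup>2 * m * \<Lambda> / m\<^sup>2)"
        using m by (simp add: real_sqrt_divide)
      also have "2 * \<sigma>\<^sup>2 * m * \<Lambda> / m\<^sup>2 = 2 * \<sigma>\<^sup>2 * \<Lambda> / m"
        using m by (simp add: power2_eq_square)
      finally show ?thesis .
    qed
    have bias: "ereal (\<bar>\<Sum>i\<in>I. g (xs i) - g x\<bar> / m) \<le> K"
    proof (cases K)
      case (real k)
      have "\<bar>g (xs i) - g x\<bar> \<le> k" if "i \<in> I" for i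
        using abs_diff_le_local_lipschitz_const[OF lip, of "xs i" x] that real \<open>x \<in> V x\<close>
        by (auto simp: K_def I_def)
      then have "\<bar>\<Sum>i\<in>I. g (xs i) - g x\<bar> \<le> m * k"
        unfolding m_def by (intro order_trans[OF sum_abs sum_bounded_above])
      with m real show ?thesis by (simp add: divide_le_eq mult.commute)
    next
      \<comment> \<open>Excluded by comparing \<open>x\<close> with itself, which shows that
        \<open>K\<close> is nonnegative.\<close>
      case MInf
      moreover have "ereal 0 \<le> K"
        using abs_diff_le_local_lipschitz_const[OF lip \<open>x \<in> V x\<close> \<open>x \<in> V x\<close>]
        unfolding K_def by (simp only: diff_self abs_zero)
      ultimately show ?thesis by simp
    qed simp
    have "ereal \<bar>local_average n xs ys V x - g x\<bar>
        \<le> ereal (\<bar>\<Sum>i\<in>I. ys i - g (xs i)\<bar> / m) + ereal (\<bar>\<Sum>i\<in>I. g (xs i) - g x\<bar> / m)"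
      using split by (simp only: plus_ereal.simps ereal_less_eq)
    also have "\<dots> \<le> ereal (sqrt (2 * \<sigma>\<^sup>2 * \<Lambda> / m)) + K"
      using variance bias by (intro add_mono) (simp_all only: ereal_less_eq)
    finally have "ereal \<bar>local_average n xs ys V x - g x\<bar> \<le> ereal (sqrt (2 * \<sigma>\<^sup>2 * \<Lambda> / m)) + K" .
    then show ?thesis
      using False unfolding error_bound_def cnt K_def \<Lambda>_def by (simp only: if_False)
  qed
qed

section \<open>Uniform deviations of conditionally sub-Gaussian noise\<close>

text \<open>Tensorisation of the conditional moment bound: each weighted coordinate contributes one
  factor \<open>c\<close>. Coordinates are integrated out one at a time. What remains is again a
  function of the \<open>f\<close>-images of the other coordinates, which is why \<open>F\<close> is
  arbitrary in the induction.\<close>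

lemma nn_integral_PiM_prod_weight_le:
  fixes P :: "'b measure" and w :: "'b \<Rightarrow> ennreal"
  assumes "sigma_finite_measure P" and "finite J" and "I \<subseteq> J"
    and [measurable]: "f \<in> P \<rightarrow>\<^sub>M Q" "w \<in> borel_measurable P"
    and bound: "\<And>h. h \<in> borel_measurable Q \<Longrightarrow>
      (\<integral>\<^sup>+z. h (f z) * w z \<partial>P) \<le> c * (\<integral>\<^sup>+z. h (f z) \<partial>P)"
    and "F \<in> borel_measurable (PiM J (\<lambda>_. Q))"
  shows "(\<integral>\<^sup>+z. F (compose J f z) * (\<Prod>i\<in>I. w (z i)) \<partial>PiM J (\<lambda>_. P))
    \<le> c ^ card I * (\<integral>\<^sup>+z. F (compose J f z) \<partial>PiM J (\<lambda>_. P))"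
  using assms(2,3,7)
proof (induction J arbitrary: I F rule: finite_induct)
  case empty
  then show ?case by simp
next
  case (insert j J)
  interpret P: sigma_finite_measure P by fact
  interpret product_sigma_finite "\<lambda>_. P" by unfold_locales
  note [measurable] = insert.prems(2)
  define I' where "I' = I - {j}"
  have I': "I' \<subseteq> J" "finite I'" "j \<notin> I'"
    using insert.prems(1) insert.hyps(1) by (auto simp: I'_def dest: finite_subset)
  define G where "G x = (\<integral>\<^sup>+y. F (x(j := f y)) \<partial>P)" for x
  have [measurable]: "G \<in> borel_measurable (PiM J (\<lambda>_. Q))"
    unfolding G_def by measurable
  have upd: "compose (insert j J) f (x(j := y)) = (compose J f x)(j := f y)" for x y
    using insert.hyps(2) by (auto simp: compose_def fun_eq_iff)
  have [measurable]: "compose J' f \<in> PiM J' (\<lambda>_. P) \<rightarrow>\<^sub>M PiM J' (\<lambda>_. Q)" for J'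
    unfolding compose_def by measurable
  have [measurable]: "(\<lambda>z. \<Prod>i\<in>I. w (z i)) \<in> borel_measurable (PiM (insert j J) (\<lambda>_. P))"
    using insert.prems(1) by (intro borel_measurable_prod_ennreal) auto
  have [measurable]: "(\<lambda>z. \<Prod>i\<in>I'. w (z i)) \<in> borel_measurable (PiM J (\<lambda>_. P))"
    using I'(1) by (intro borel_measurable_prod_ennreal) auto
  \<comment> \<open>The power of \<open>c\<close> is \<open>c\<close> if \<open>j\<close> carries a
    weight and \<open>1\<close> otherwise, so both cases share one formula.\<close>
  have inner: "(\<integral>\<^sup>+y. F ((compose J f x)(j := f y)) * (\<Prod>i\<in>I. w ((x(j := y)) i)) \<partial>P)
      \<le> c ^ (card I - card I') * (G (compose J f x) * (\<Prod>i\<in>I'. w (x i)))"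
    if x: "x \<in> space (PiM J (\<lambda>_. P))" for x
  proof -
    have cx: "compose J f x \<in> space (PiM J (\<lambda>_. Q))"
      using x by (rule measurable_space[rotated]) measurable
    have h[measurable]: "(\<lambda>q. F ((compose J f x)(j := q))) \<in> borel_measurable Q"
      using measurable_comp[OF measurable_component_update[OF cx insert.hyps(2)] insert.prems(2)]
      by (simp add: comp_def)
    have same: "(\<Prod>i\<in>I'. w ((x(j := y)) i)) = (\<Prod>i\<in>I'. w (x i))" for y
      using I'(3) by (intro prod.cong) auto
    show ?thesis
    proof (cases "j \<in> I")
      case True
      then have I: "I = insert j I'" by (auto simp: I'_def)
      have "(\<integral>\<^sup>+y. F ((compose J f x)(j := f y)) * (\<Prod>i\<in>I. w ((x(j := y)) i)) \<partial>P)
          = (\<integral>\<^sup>+y. F ((compose J f x)(j := f y)) * w y * (\<Prod>i\<in>I'. w (x i)) \<partial>P)"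
        unfolding I using I'(2,3) same by (simp add: mult_ac del: fun_upd_apply) (simp add: mult_ac)
      also have "\<dots> = (\<integral>\<^sup>+y. F ((compose J f x)(j := f y)) * w y \<partial>P) * (\<Prod>i\<in>I'. w (x i))"
        by (rule nn_integral_multc) measurable
      also have "\<dots> \<le> c * G (compose J f x) * (\<Prod>i\<in>I'. w (x i))"
        unfolding G_def by (intro mult_right_mono bound[OF h]) auto
      finally show ?thesis using I I'(2,3) by (simp add: mult_ac)
    next
      case False
      then have I: "I = I'" by (auto simp: I'_def)
      have "(\<integral>\<^sup>+y. F ((compose J f x)(j := f y)) * (\<Prod>i\<in>I. w ((x(j := y)) i)) \<partial>P)
          = G (compose J f x) * (\<Prod>i\<in>I'. w (x i))"
        unfolding I same G_def by (rule nn_integral_multc) measurable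
      then show ?thesis using I by simp
    qed
  qed
  have "card I' \<le> card I" using insert.prems(1) insert.hyps(1)
    by (auto simp: I'_def intro!: card_mono dest: finite_subset)
  have "(\<integral>\<^sup>+z. F (compose (insert j J) f z) * (\<Prod>i\<in>I. w (z i)) \<partial>PiM (insert j J) (\<lambda>_. P))
      = (\<integral>\<^sup>+x. \<integral>\<^sup>+y. F ((compose J f x)(j := f y)) * (\<Prod>i\<in>I. w ((x(j := y)) i)) \<partial>P \<partial>PiM J (\<lambda>_. P))"
    by (subst product_nn_integral_insert[OF insert.hyps]) (measurable, simp only: upd)
  also have "\<dots> \<le> (\<integral>\<^sup>+x. c ^ (card I - card I') * (G (compose J f x) * (\<Prod>i\<in>I'. w (x i))) \<partial>PiM J (\<lambda>_. P))"
    by (intro nn_integral_mono inner)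
  also have "\<dots> = c ^ (card I - card I') * (\<integral>\<^sup>+x. G (compose J f x) * (\<Prod>i\<in>I'. w (x i)) \<partial>PiM J (\<lambda>_. P))"
    by (rule nn_integral_cmult) measurable
  also have "\<dots> \<le> c ^ (card I - card I') * (c ^ card I' * (\<integral>\<^sup>+x. G (compose J f x) \<partial>PiM J (\<lambda>_. P)))"
    by (intro mult_left_mono insert.IH I') auto
  also have "\<dots> = c ^ card I * (\<integral>\<^sup>+x. G (compose J f x) \<partial>PiM J (\<lambda>_. P))"
    using \<open>card I' \<le> card I\<close> by (simp add: mult.assoc[symmetric] power_add[symmetric])
  also have "(\<integral>\<^sup>+x. G (compose J f x) \<partial>PiM J (\<lambda>_. P))
      = (\<integral>\<^sup>+z. F (compose (insert j J) f z) \<partial>PiM (insert j J) (\<lambda>_. P))"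
    unfolding G_def by (subst product_nn_integral_insert[OF insert.hyps]) (measurable, simp only: upd)
  finally show ?case .
qed

text \<open>\<open>mgf_le\<close> is the bound on the moment generating function of \<open>e\<close> conditionally on \<open>f\<close>, in a weak
  form that avoids conditional expectations.\<close>

locale subgaussian_noise = prob_space P for P :: "'b measure" +
  fixes Q :: "'c measure" and f :: "'b \<Rightarrow> 'c" and e :: "'b \<Rightarrow> real" and s :: real
  assumes f_measurable [measurable]: "f \<in> P \<rightarrow>\<^sub>M Q"
    and e_measurable [measurable]: "e \<in> borel_measurable P"
    and mgf_le: "h \<in> borel_measurable Q \<Longrightarrow>
      (\<integral>\<^sup>+z. h (f z) * ennreal (exp (t * e z)) \<partial>P)
        \<le> ennreal (exp (t\<^sup>2 * s / 2)) * (\<integral>\<^sup>+z. h (f z) \<partial>P)"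
    and s_nonneg: "0 \<le> s"
begin

lemma uminus_noise: "subgaussian_noise P Q f (\<lambda>z. - e z) s"
proof
  fix h :: "'c \<Rightarrow> ennreal" and t :: real
  assume "h \<in> borel_measurable Q"
  from mgf_le[OF this, of "- t"]
  show "(\<integral>\<^sup>+z. h (f z) * ennreal (exp (t * - e z)) \<partial>P)
      \<le> ennreal (exp (t\<^sup>2 * s / 2)) * (\<integral>\<^sup>+z. h (f z) \<partial>P)"
    by simp
qed (use s_nonneg in measurable)

lemma measurable_compose_PiM [measurable]: "compose J f \<in> PiM J (\<lambda>_. P) \<rightarrow>\<^sub>M PiM J (\<lambda>_. Q)"
  unfolding compose_def by measurable

lemma measurable_sum_noise:
  "I \<subseteq> J \<Longrightarrow> (\<lambda>z. \<Sum>i\<in>I. e (z i)) \<in> borel_measurable (PiM J (\<lambda>_. P))"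
  by (intro borel_measurable_sum) auto

text \<open>Exponential Markov inequality, restricted to an event \<open>B\<close> about the
  observed parts \<open>f (z i)\<close>. Keeping the probability of \<open>B\<close> as a factor
  stands in for conditioning on those parts and is what later allows a weighted union bound.\<close>

lemma chernoff:
  assumes "finite J" and "I \<subseteq> J" and [measurable]: "B \<in> sets (PiM J (\<lambda>_. Q))" and "0 \<le> t"
  shows "emeasure (PiM J (\<lambda>_. P))
      {z \<in> space (PiM J (\<lambda>_. P)). compose J f z \<in> B \<and> u < (\<Sum>i\<in>I. e (z i))}
    \<le> ennreal (exp (t\<^sup>2 * s / 2 * real (card I) - t * u))
      * emeasure (PiM J (\<lambda>_. P)) {z \<in> space (PiM J (\<lambda>_. P)). compose J f z \<in> B}"
    (is "emeasure ?W ?L \<le> _ * emeasure ?W ?R")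
proof -
  let ?w = "\<lambda>z. ennreal (exp (t * e z))"
  have [measurable]: "(\<lambda>z. \<Sum>i\<in>I. e (z i)) \<in> borel_measurable ?W"
    using assms(2) by (rule measurable_sum_noise)
  have [measurable]: "(\<lambda>z. \<Prod>i\<in>I. ?w (z i)) \<in> borel_measurable ?W"
    using assms(2) by (intro borel_measurable_prod_ennreal) auto
  have prod: "(\<Prod>i\<in>I. ?w (z i)) = ennreal (exp (t * (\<Sum>i\<in>I. e (z i))))" for z
    using finite_subset[OF assms(2,1)]
    by (simp add: prod_ennreal exp_sum[symmetric] sum_distrib_left)
  have "emeasure ?W ?L = (\<integral>\<^sup>+z. indicator ?L z \<partial>?W)"
    by (rule nn_integral_indicator[symmetric]) measurable
  also have "\<dots> \<le> (\<integral>\<^sup>+z. ennreal (exp (- t * u)) * (indicator B (compose J f z) * (\<Prod>i\<in>I. ?w (z i))) \<partial>?W)"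
  proof (intro nn_integral_mono)
    fix z
    show "indicator ?L z \<le> ennreal (exp (- t * u)) * (indicator B (compose J f z) * (\<Prod>i\<in>I. ?w (z i)))"
    proof (cases "z \<in> ?L")
      case True
      then have "0 \<le> t * ((\<Sum>i\<in>I. e (z i)) - u)"
        using assms(4) by (intro mult_nonneg_nonneg) auto
      then have "1 \<le> ennreal (exp (- t * u + t * (\<Sum>i\<in>I. e (z i))))"
        by (simp add: algebra_simps)
      moreover have "indicator ?L z = (1 :: ennreal)" "indicator B (compose J f z) = (1 :: ennreal)"
        using True by auto
      ultimately show ?thesis
        unfolding prod by (simp only: mult_1 exp_add ennreal_mult' exp_ge_zero)
    qed simp
  qed
  also have "\<dots> = ennreal (exp (- t * u)) * (\<integral>\<^sup>+z. indicator B (compose J f z) * (\<Prod>i\<in>I. ?w (z i)) \<partial>?W)"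
    by (rule nn_integral_cmult) measurable
  also have "\<dots> \<le> ennreal (exp (- t * u)) * (ennreal (exp (t\<^sup>2 * s / 2)) ^ card I * (\<integral>\<^sup>+z. indicator B (compose J f z) \<partial>?W))"
    using assms(1,2)
    by (intro mult_left_mono nn_integral_PiM_prod_weight_le mgf_le sigma_finite_measure_axioms) auto
  also have "(\<integral>\<^sup>+z. indicator B (compose J f z) \<partial>?W) = (\<integral>\<^sup>+z. indicator ?R z \<partial>?W)"
    by (intro nn_integral_cong) (auto simp: indicator_def)
  also have "\<dots> = emeasure ?W ?R"
    by (rule nn_integral_indicator) measurable
  also have "ennreal (exp (- t * u)) * (ennreal (exp (t\<^sup>2 * s / 2)) ^ card I * emeasure ?W ?R)
      = ennreal (exp (- t * u) * exp (t\<^sup>2 * s / 2) ^ card I) * emeasure ?W ?R"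
    by (simp add: ennreal_power ennreal_mult' mult.assoc)
  also have "exp (- t * u) * exp (t\<^sup>2 * s / 2) ^ card I = exp (t\<^sup>2 * s / 2 * real (card I) - t * u)"
    by (simp add: exp_of_nat_mult[symmetric] exp_add[symmetric] algebra_simps)
  finally show ?thesis .
qed

lemma sum_gt_sqrt_le:
  assumes "finite J" and "I \<subseteq> J" and [measurable]: "B \<in> sets (PiM J (\<lambda>_. Q))" and "0 \<le> \<Lambda>"
  shows "emeasure (PiM J (\<lambda>_. P))
      {z \<in> space (PiM J (\<lambda>_. P)). compose J f z \<in> B \<and> sqrt (2 * s * real (card I) * \<Lambda>) < (\<Sum>i\<in>I. e (z i))}
    \<le> ennreal (exp (- \<Lambda>))
      * emeasure (PiM J (\<lambda>_. P)) {z \<in> space (PiM J (\<lambda>_. P)). compose J f z \<in> B}"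
proof -
  let ?W = "PiM J (\<lambda>_. P)"
  let ?m = "real (card I)"
  let ?L = "\<lambda>u. {z \<in> space ?W. compose J f z \<in> B \<and> u < (\<Sum>i\<in>I. e (z i))}"
  interpret W: prob_space ?W by (intro prob_space_PiM prob_space_axioms)
  have [measurable]: "(\<lambda>z. \<Sum>i\<in>I. e (z i)) \<in> borel_measurable ?W"
    using assms(2) by (rule measurable_sum_noise)
  show ?thesis
  proof (cases "s * ?m = 0")
    case False
    \<comment> \<open>\<open>a\<close> is the variance proxy of the sum and \<open>T\<close> the
      threshold; \<open>t = T / a\<close> minimises the Chernoff exponent
      \<open>t\<^sup>2 * a / 2 - t * T\<close>.\<close>
    define a where "a = s * ?m"
    define T where "T = sqrt (2 * a * \<Lambda>)"
    have "0 \<le> a" unfolding a_def by (intro mult_nonneg_nonneg s_nonneg) simp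
    then have a: "0 < a" using False unfolding a_def by linarith
    have "T\<^sup>2 = 2 * a * \<Lambda>" "0 \<le> T" using a assms(4) by (simp_all add: T_def)
    have "(T / a)\<^sup>2 * s / 2 * ?m - T / a * T = T\<^sup>2 * (a / (2 * a\<^sup>2) - 1 / a)"
      by (simp add: a_def power2_eq_square algebra_simps)
    also have "\<dots> = - \<Lambda>"
      using a \<open>T\<^sup>2 = _\<close> by (simp add: power2_eq_square field_simps)
    finally have expo: "(T / a)\<^sup>2 * s / 2 * ?m - T / a * T = - \<Lambda>" .
    have "0 \<le> T / a" using a \<open>0 \<le> T\<close> by simp
    from chernoff[OF assms(1-3) this, of T] show ?thesis
      unfolding expo unfolding T_def a_def by (simp only: mult.assoc)
  next
    case True
    \<comment> \<open>Chernoff with \<open>t \<rightarrow> \<infinity>\<close>.\<close>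
    have "emeasure ?W (?L (inverse (real (Suc k)))) = 0" (is "emeasure _ ?A = 0") for k
    proof (rule ccontr)
      assume "emeasure ?W ?A \<noteq> 0"
      then have pos: "0 < measure ?W ?A"
        using measure_nonneg[of ?W ?A] by (simp add: W.emeasure_eq_measure order_less_le)
      \<comment> \<open>With the quadratic term gone, this \<open>t\<close> makes the exponent at
        threshold \<open>1 / (k + 1)\<close> equal to \<open>ln p - 1\<close>, where
        \<open>p\<close> is the probability of \<open>?A\<close>. Then \<open>p\<close> would be at
        most \<open>p / exp 1\<close>, which is impossible for positive \<open>p\<close>.\<close>
      define t where "t = real (Suc k) * (1 - ln (measure ?W ?A))"
      have "ln (measure ?W ?A) \<le> 0" using pos by (simp add: W.prob_le_1)
      then have "0 \<le> t" unfolding t_def by (intro mult_nonneg_nonneg) auto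
      have expo: "t\<^sup>2 * s / 2 * ?m - t * inverse (real (Suc k)) = ln (measure ?W ?A) - 1"
        using True unfolding t_def by (auto simp: field_simps)
      have "emeasure ?W ?A \<le> ennreal (exp (ln (measure ?W ?A) - 1)) * emeasure ?W {z \<in> space ?W. compose J f z \<in> B}"
        using chernoff[OF assms(1-3) \<open>0 \<le> t\<close>, of "inverse (real (Suc k))"] unfolding expo .
      also have "\<dots> \<le> ennreal (exp (ln (measure ?W ?A) - 1)) * 1"
        by (intro mult_left_mono W.emeasure_le_1) simp
      finally have "measure ?W ?A \<le> exp (ln (measure ?W ?A) - 1)"
        by (simp add: W.emeasure_eq_measure)
      also have "\<dots> < exp (ln (measure ?W ?A))" by (subst exp_less_cancel_iff) simp
      finally show False using pos by simp
    qed
    moreover have meas: "?L u \<in> sets ?W" for u by measurable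
    ultimately have null: "emeasure ?W (\<Union>k. ?L (inverse (real (Suc k)))) = 0"
      by (intro emeasure_UN_eq_0) blast+
    \<comment> \<open>The threshold is zero in this case, and a strictly positive sum exceeds some
      \<open>1 / (k + 1)\<close>.\<close>
    have "?L 0 \<subseteq> (\<Union>k. ?L (inverse (real (Suc k))))"
      using reals_Archimedean by blast
    then have "emeasure ?W (?L 0) \<le> emeasure ?W (\<Union>k. ?L (inverse (real (Suc k))))"
      using meas by (intro emeasure_mono sets.countable_UN) blast+
    then have "emeasure ?W (?L 0) = 0"
      unfolding null by (simp only: le_zero_eq)
    moreover have "2 * s * ?m * \<Lambda> = 0" using True by auto
    ultimately show ?thesis by (simp only: real_sqrt_zero zero_le)
  qed
qed

lemma abs_sum_gt_sqrt_le:
  assumes "finite J" and "I \<subseteq> J" and [measurable]: "B \<in> sets (PiM J (\<lambda>_. Q))" and "0 \<le> \<Lambda>"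
  shows "emeasure (PiM J (\<lambda>_. P))
      {z \<in> space (PiM J (\<lambda>_. P)). compose J f z \<in> B \<and> sqrt (2 * s * real (card I) * \<Lambda>) < \<bar>\<Sum>i\<in>I. e (z i)\<bar>}
    \<le> ennreal (2 * exp (- \<Lambda>))
      * emeasure (PiM J (\<lambda>_. P)) {z \<in> space (PiM J (\<lambda>_. P)). compose J f z \<in> B}"
    (is "emeasure ?W ?L \<le> _ * emeasure ?W ?R")
proof -
  interpret neg: subgaussian_noise P Q f "\<lambda>z. - e z" s by (rule uminus_noise)
  let ?T = "sqrt (2 * s * real (card I) * \<Lambda>)"
  let ?L1 = "{z \<in> space ?W. compose J f z \<in> B \<and> ?T < (\<Sum>i\<in>I. e (z i))}"
  let ?L2 = "{z \<in> space ?W. compose J f z \<in> B \<and> ?T < (\<Sum>i\<in>I. - e (z i))}"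
  have [measurable]: "(\<lambda>z. \<Sum>i\<in>I. e (z i)) \<in> borel_measurable ?W"
    using assms(2) by (rule measurable_sum_noise)
  have [measurable]: "?L1 \<in> sets ?W" by measurable
  have [measurable]: "?L2 \<in> sets ?W" unfolding sum_negf by measurable
  have "?L = ?L1 \<union> ?L2" by (auto simp: sum_negf)
  then have "emeasure ?W ?L \<le> emeasure ?W ?L1 + emeasure ?W ?L2"
    by (simp only: emeasure_subadditive \<open>?L1 \<in> sets ?W\<close> \<open>?L2 \<in> sets ?W\<close>)
  also have "\<dots> \<le> ennreal (exp (- \<Lambda>)) * emeasure ?W ?R + ennreal (exp (- \<Lambda>)) * emeasure ?W ?R"
    using assms by (intro add_mono sum_gt_sqrt_le neg.sum_gt_sqrt_le)
  also have "\<dots> = ennreal (2 * exp (- \<Lambda>)) * emeasure ?W ?R"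
    by (simp add: distrib_right[symmetric] ennreal_plus[symmetric] del: ennreal_plus)
  finally show ?thesis .
qed

lemma distr_PiM_compose:
  assumes "finite J"
  shows "distr (PiM J (\<lambda>_. P)) (PiM J (\<lambda>_. distr P Q f)) (compose J f) = PiM J (\<lambda>_. distr P Q f)"
proof -
  have "distr (PiM J (\<lambda>_. P)) (PiM J (\<lambda>_. distr P Q f)) (compose J f)
      = PiM J (\<lambda>_. distr P (distr P Q f) f)"
    by (intro distr_PiM_finite_prob_space' assms prob_space_axioms prob_space_distr) measurable
  also have "distr P (distr P Q f) f = distr P Q f"
    by (rule distr_cong) auto
  finally show ?thesis .
qed

text \<open>Union bound over all \<open>I\<close>, each weighted by the probability that
  \<open>C I\<close> occurs. These probabilities add up to the expected number of index sets picked
  out, at most \<open>k\<close>, so the number of all subsets of \<open>J\<close> never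
  enters.\<close>

lemma uniform_deviation:
  fixes C :: "'i set \<Rightarrow> ('i \<Rightarrow> 'c) set"
  assumes "finite J" and "0 \<le> \<Lambda>"
    and C: "\<And>I. I \<subseteq> J \<Longrightarrow> C I \<in> sets (completion (PiM J (\<lambda>_. distr P Q f)))"
    and count: "\<And>x. x \<in> space (PiM J (\<lambda>_. Q)) \<Longrightarrow> card {I. I \<subseteq> J \<and> x \<in> C I} \<le> k"
  shows "\<exists>E\<in>sets (PiM J (\<lambda>_. P)). emeasure (PiM J (\<lambda>_. P)) E \<le> ennreal (2 * exp (- \<Lambda>) * real k) \<and>
    (\<forall>z\<in>space (PiM J (\<lambda>_. P)) - E. \<forall>I\<subseteq>J. compose J f z \<in> C I \<longrightarrow>
      \<bar>\<Sum>i\<in>I. e (z i)\<bar> \<le> sqrt (2 * s * real (card I) * \<Lambda>))"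
proof -
  let ?W = "PiM J (\<lambda>_. P)"
  let ?D = "PiM J (\<lambda>_. distr P Q f)"
  have sets_D: "sets ?D = sets (PiM J (\<lambda>_. Q))" by (intro sets_PiM_cong) auto
  have space_D: "space ?D = space (PiM J (\<lambda>_. Q))" by (rule sets_eq_imp_space_eq[OF sets_D])
  interpret D: prob_space ?D by (intro prob_space_PiM prob_space_distr) measurable
  \<comment> \<open>The \<open>C I\<close> are measurable only for the completion. The tail bounds
    need genuine product-measurable events, hence measurable hulls of the same measure.\<close>
  have "\<exists>B. \<forall>I\<in>Pow J. B I \<in> sets ?D \<and> C I \<subseteq> B I \<and> emeasure (completion ?D) (C I) = emeasure ?D (B I)"
  proof (intro bchoice ballI)
    fix I assume "I \<in> Pow J"
    then have "C I \<in> sets (completion ?D)" using C by blast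
    from completion_upper[OF this] show "\<exists>A. A \<in> sets ?D \<and> C I \<subseteq> A \<and>
        emeasure (completion ?D) (C I) = emeasure ?D A"
      by blast
  qed
  then obtain B where B: "\<And>I. I \<subseteq> J \<Longrightarrow> B I \<in> sets ?D" "\<And>I. I \<subseteq> J \<Longrightarrow> C I \<subseteq> B I"
      "\<And>I. I \<subseteq> J \<Longrightarrow> emeasure (completion ?D) (C I) = emeasure ?D (B I)"
    by auto
  define R where "R I = {z \<in> space ?W. compose J f z \<in> B I}" for I
  define L where "L I = {z \<in> space ?W. compose J f z \<in> B I \<and>
    sqrt (2 * s * real (card I) * \<Lambda>) < \<bar>\<Sum>i\<in>I. e (z i)\<bar>}" for I
  have finI: "finite (Pow J)" using assms(1) by simp
  have L_sets: "L I \<in> sets ?W" if "I \<subseteq> J" for I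
  proof -
    have [measurable]: "B I \<in> sets (PiM J (\<lambda>_. Q))" using B(1)[OF that] by (simp add: sets_D)
    have [measurable]: "(\<lambda>z. \<Sum>i\<in>I. e (z i)) \<in> borel_measurable ?W"
      using that by (rule measurable_sum_noise)
    show ?thesis unfolding L_def by measurable
  qed
  \<comment> \<open>The image of the product law under \<open>compose J f\<close> is
    \<open>?D\<close>, so pulling back a hull preserves its measure.\<close>
  have R_eq: "emeasure ?W (R I) = emeasure (completion ?D) (C I)" if "I \<subseteq> J" for I
  proof -
    have "compose J f \<in> ?W \<rightarrow>\<^sub>M ?D"
      using measurable_cong_sets[OF refl sets_D] measurable_compose_PiM by blast
    then have "emeasure (distr ?W ?D (compose J f)) (B I) = emeasure ?W (R I)"
      using B(1)[OF that] unfolding R_def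
      by (subst emeasure_distr) (auto intro!: arg_cong[where f = "emeasure ?W"])
    then show ?thesis using B(3)[OF that] by (simp add: distr_PiM_compose[OF assms(1)])
  qed
  have "emeasure ?W (\<Union>I\<in>Pow J. L I) \<le> (\<Sum>I\<in>Pow J. emeasure ?W (L I))"
    using finI L_sets by (intro emeasure_subadditive_finite) auto
  also have "\<dots> \<le> (\<Sum>I\<in>Pow J. ennreal (2 * exp (- \<Lambda>)) * emeasure ?W (R I))"
    unfolding L_def R_def using B(1) assms(1,2)
    by (intro sum_mono abs_sum_gt_sqrt_le) (auto simp: sets_D)
  also have "\<dots> = ennreal (2 * exp (- \<Lambda>)) * (\<Sum>I\<in>Pow J. emeasure (completion ?D) (C I))"
    by (simp add: R_eq sum_distrib_left)
  \<comment> \<open>The bound on the count concerns the sets \<open>C I\<close>, not their possibly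
    larger hulls. The sum is therefore exchanged with an integral over the completion, where the
    indicators of the \<open>C I\<close> are measurable.\<close>
  also have "(\<Sum>I\<in>Pow J. emeasure (completion ?D) (C I))
      = (\<Sum>I\<in>Pow J. \<integral>\<^sup>+x. indicator (C I) x \<partial>completion ?D)"
    using C by (intro sum.cong) auto
  also have "\<dots> = (\<integral>\<^sup>+x. (\<Sum>I\<in>Pow J. indicator (C I) x) \<partial>completion ?D)"
    using C by (intro nn_integral_sum[symmetric]) auto
  also have "\<dots> \<le> (\<integral>\<^sup>+x. of_nat k \<partial>completion ?D)"
  proof (intro nn_integral_mono)
    fix x assume "x \<in> space (completion ?D)"
    then have "x \<in> space (PiM J (\<lambda>_. Q))" by (simp add: space_D)
    have "(\<Sum>I\<in>Pow J. indicator (C I) x) = (\<Sum>I\<in>Pow J. if x \<in> C I then 1 else 0 :: ennreal)"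
      by (intro sum.cong) (auto simp: indicator_def)
    also have "\<dots> = (\<Sum>I\<in>{I \<in> Pow J. x \<in> C I}. 1)"
      by (rule sum.inter_filter[symmetric, OF finI])
    also have "\<dots> = of_nat (card {I. I \<subseteq> J \<and> x \<in> C I})" by simp
    also have "\<dots> \<le> of_nat k"
      using count[OF \<open>x \<in> space (PiM J (\<lambda>_. Q))\<close>] by simp
    finally show "(\<Sum>I\<in>Pow J. indicator (C I) x) \<le> (of_nat k :: ennreal)" .
  qed
  also have "\<dots> = of_nat k" by (simp add: D.emeasure_space_1)
  finally have "emeasure ?W (\<Union>I\<in>Pow J. L I) \<le> ennreal (2 * exp (- \<Lambda>)) * of_nat k"
    by (simp add: mult_left_mono)
  then have "emeasure ?W (\<Union>I\<in>Pow J. L I) \<le> ennreal (2 * exp (- \<Lambda>) * real k)"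
    by (simp add: ennreal_mult' ennreal_of_nat_eq_real_of_nat)
  moreover have "(\<Union>I\<in>Pow J. L I) \<in> sets ?W"
    using finI L_sets by (intro sets.finite_UN) auto
  moreover have "\<bar>\<Sum>i\<in>I. e (z i)\<bar> \<le> sqrt (2 * s * real (card I) * \<Lambda>)"
    if "z \<in> space ?W - (\<Union>I\<in>Pow J. L I)" "I \<subseteq> J" "compose J f z \<in> C I" for z I
    using that B(2)[OF that(2)] unfolding L_def by (fastforce simp: not_less)
  ultimately show ?thesis by blast
qed

end

section \<open>The sample as a random element of the subspace product\<close>

text \<open>The identity, written as a pair, is measurable from the restricted product to the
  product with the subspace; its preimages give the traces, without \<open>S\<close> being
  Borel.\<close>

lemma sets_restrict_pair:
  assumes "A \<in> sets (restrict_space M S \<Otimes>\<^sub>M N)" and "space N = UNIV"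
  obtains B where "B \<in> sets (M \<Otimes>\<^sub>M N)" "A = B \<inter> S \<times> UNIV"
proof -
  let ?R = "restrict_space (M \<Otimes>\<^sub>M N) (S \<times> UNIV)"
  have "(\<lambda>z. (fst z, snd z)) \<in> ?R \<rightarrow>\<^sub>M restrict_space M S \<Otimes>\<^sub>M N"
    by (intro measurable_Pair measurable_restrict_space2 measurable_restrict_space1)
      (auto simp: space_restrict_space)
  from measurable_sets[OF this assms(1)]
  have "A \<inter> space ?R \<in> sets ?R" by (simp add: vimage_def Int_def)
  moreover have "A \<subseteq> space ?R"
    using sets.sets_into_space[OF assms(1)] assms(2)
    by (auto simp: space_restrict_space space_pair_measure)
  ultimately have "A \<in> sets ?R" by (simp add: Int_absorb2)
  then show ?thesis
    using that by (auto simp: sets_restrict_space Int_commute)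
qed

text \<open>\<open>g\<close> is measurable only on the subspace \<open>S\<close>, so independence
  and equality of laws are transferred to a product in which the noise is measurable.\<close>

lemma (in prob_space) sample_in_subspace:
  fixes X :: "nat \<Rightarrow> 'a \<Rightarrow> 'b::euclidean_space" and Y :: "nat \<Rightarrow> 'a \<Rightarrow> real"
  assumes iid: "iid_sample M X Y n"
    and X_S: "\<And>i \<omega>. i \<le> n \<Longrightarrow> \<omega> \<in> space M \<Longrightarrow> X i \<omega> \<in> S"
  defines "N \<equiv> restrict_space borel S \<Otimes>\<^sub>M borel"
  shows "i \<le> n \<Longrightarrow> (\<lambda>\<omega>. (X i \<omega>, Y i \<omega>)) \<in> M \<rightarrow>\<^sub>M N"
    and "indep_vars (\<lambda>_. N) (\<lambda>i \<omega>. (X i \<omega>, Y i \<omega>)) {0..n}"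
    and "i \<le> n \<Longrightarrow> distr M N (\<lambda>\<omega>. (X i \<omega>, Y i \<omega>)) = distr M N (\<lambda>\<omega>. (X 0 \<omega>, Y 0 \<omega>))"
proof -
  let ?Z = "\<lambda>i \<omega>. (X i \<omega>, Y i \<omega>)"
  let ?N = "borel \<Otimes>\<^sub>M borel :: ('b \<times> real) measure"
  have indep: "indep_vars (\<lambda>_. ?N) ?Z {0..n}"
    using iid unfolding iid_sample_def by (elim conjE)
  have "\<forall>i\<in>{0..n}. distr M ?N (?Z i) = distr M ?N (?Z 0)"
    using iid unfolding iid_sample_def by (elim conjE)
  then have law: "distr M ?N (?Z i) = distr M ?N (?Z 0)" if "i \<le> n" for i
    using that by (meson atLeastAtMost_iff le0)
  have Z: "?Z i \<in> M \<rightarrow>\<^sub>M ?N" if "i \<le> n" for i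
    using indep that unfolding indep_vars_def2 by (meson atLeastAtMost_iff le0)
  show Z': "?Z i \<in> M \<rightarrow>\<^sub>M N" if "i \<le> n" for i
  proof -
    have "(\<lambda>\<omega>. fst (?Z i \<omega>)) \<in> M \<rightarrow>\<^sub>M borel" "(\<lambda>\<omega>. snd (?Z i \<omega>)) \<in> M \<rightarrow>\<^sub>M borel"
      by (rule measurable_compose[OF Z[OF that]], rule measurable_fst measurable_snd)+
    then show ?thesis
      unfolding N_def using X_S[OF that]
      by (intro measurable_Pair measurable_restrict_space2) auto
  qed
  \<comment> \<open>Since every \<open>X i\<close> lies in \<open>S\<close>, a single
    \<open>B\<close> serves all indices at once; this uniformity is what transfers equality of
    laws.\<close>
  have vimage: "\<exists>B\<in>sets ?N. \<forall>i\<le>n. ?Z i -` A \<inter> space M = ?Z i -` B \<inter> space M" if A: "A \<in> sets N" for A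
  proof -
    obtain B where "B \<in> sets ?N" "A = B \<inter> S \<times> UNIV"
      by (rule sets_restrict_pair[OF A[unfolded N_def] space_borel])
    then show ?thesis using X_S by (intro bexI[of _ B]) auto
  qed
  show "indep_vars (\<lambda>_. N) ?Z {0..n}"
    unfolding indep_vars_def2
  proof
    show "indep_sets (\<lambda>i. {?Z i -` A \<inter> space M |A. A \<in> sets N}) {0..n}"
    proof (rule indep_sets_mono_sets)
      show "indep_sets (\<lambda>i. {?Z i -` A \<inter> space M |A. A \<in> sets ?N}) {0..n}"
        using indep by (simp add: indep_vars_def2)
      fix i assume i: "i \<in> {0..n}"
      show "{?Z i -` A \<inter> space M |A. A \<in> sets N} \<subseteq> {?Z i -` A \<inter> space M |A. A \<in> sets ?N}"
      proof
        fix D assume "D \<in> {?Z i -` A \<inter> space M |A. A \<in> sets N}"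
        then obtain A where "A \<in> sets N" and D: "D = ?Z i -` A \<inter> space M" by blast
        with vimage obtain B where "B \<in> sets ?N" "?Z i -` A \<inter> space M = ?Z i -` B \<inter> space M"
          using i by (meson atLeastAtMost_iff)
        with D show "D \<in> {?Z i -` A \<inter> space M |A. A \<in> sets ?N}" by blast
      qed
    qed
  qed (use Z' in auto)
  show "distr M N (?Z i) = distr M N (?Z 0)" if "i \<le> n"
  proof (rule measure_eqI)
    fix A assume "A \<in> sets (distr M N (?Z i))"
    then have A: "A \<in> sets N" by simp
    from vimage[OF A] obtain B where B: "B \<in> sets ?N"
      "\<And>i. i \<le> n \<Longrightarrow> ?Z i -` A \<inter> space M = ?Z i -` B \<inter> space M"
      by blast
    have "emeasure (distr M N (?Z j)) A = emeasure (distr M ?N (?Z 0)) B" if "j \<le> n" for j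
      unfolding law[OF that, symmetric] emeasure_distr[OF Z'[OF that] A] emeasure_distr[OF Z[OF that] B(1)]
      by (simp only: B(2)[OF that])
    from this[OF that] this[OF le0]
    show "emeasure (distr M N (?Z i)) A = emeasure (distr M N (?Z 0)) A" by (simp only:)
  qed simp
qed

text \<open>\<open>h (X \<omega>)\<close> is measurable for the conditioning algebra, so the
  defining property of \<open>nn_cond_exp\<close> brings the conditional moment under the integral,
  where its almost sure bound applies.\<close>

lemma (in prob_space) nn_integral_cond_subgaussian:
  fixes X :: "'a \<Rightarrow> 'b::topological_space"
  assumes sub: "cond_subgaussian M (sigma_gen M X) \<epsilon> s"
    and X: "X \<in> borel_measurable M" and X_S: "\<And>\<omega>. \<omega> \<in> space M \<Longrightarrow> X \<omega> \<in> S"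
    and h: "h \<in> borel_measurable (restrict_space borel S)"
  shows "(\<integral>\<^sup>+\<omega>. h (X \<omega>) * ennreal (exp (t * \<epsilon> \<omega>)) \<partial>M)
    \<le> ennreal (exp (t\<^sup>2 * s / 2)) * (\<integral>\<^sup>+\<omega>. h (X \<omega>) \<partial>M)"
proof -
  let ?F = "sigma_gen M X"
  have "subalgebra M ?F"
    using X by (auto simp: subalgebra_def sigma_gen_def sets_vimage_algebra2 intro: measurable_sets)
  then interpret finite_measure_subalgebra M ?F by unfold_locales
  have [measurable]: "\<epsilon> \<in> borel_measurable M"
    using sub by (auto simp: cond_subgaussian_def)
  have "X \<in> ?F \<rightarrow>\<^sub>M restrict_space borel S"
    unfolding sigma_gen_def using X_S
    by (intro measurable_restrict_space2 measurable_vimage_algebra1) auto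
  then have hX [measurable]: "(\<lambda>\<omega>. h (X \<omega>)) \<in> borel_measurable ?F"
    by (rule measurable_compose[OF _ h])
  have [measurable]: "(\<lambda>\<omega>. h (X \<omega>)) \<in> borel_measurable M"
    by (rule measurable_from_subalg[OF subalg hX])
  have "(\<integral>\<^sup>+\<omega>. h (X \<omega>) * ennreal (exp (t * \<epsilon> \<omega>)) \<partial>M)
      = (\<integral>\<^sup>+\<omega>. h (X \<omega>) * nn_cond_exp M ?F (\<lambda>\<omega>. ennreal (exp (t * \<epsilon> \<omega>))) \<omega> \<partial>M)"
    by (rule nn_cond_exp_intg[symmetric]) measurable
  also have "\<dots> \<le> (\<integral>\<^sup>+\<omega>. ennreal (exp (t\<^sup>2 * s / 2)) * h (X \<omega>) \<partial>M)"
  proof (rule nn_integral_mono_AE)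
    have "AE \<omega> in M. nn_cond_exp M ?F (\<lambda>\<omega>. ennreal (exp (t * \<epsilon> \<omega>))) \<omega> \<le> ennreal (exp (t\<^sup>2 * s / 2))"
      using sub unfolding cond_subgaussian_def by blast
    then show "AE \<omega> in M. h (X \<omega>) * nn_cond_exp M ?F (\<lambda>\<omega>. ennreal (exp (t * \<epsilon> \<omega>))) \<omega>
        \<le> ennreal (exp (t\<^sup>2 * s / 2)) * h (X \<omega>)"
      by eventually_elim (metis mult.commute mult_left_mono zero_le)
  qed
  also have "\<dots> = ennreal (exp (t\<^sup>2 * s / 2)) * (\<integral>\<^sup>+\<omega>. h (X \<omega>) \<partial>M)"
    by (rule nn_integral_cmult) measurable
  finally show ?thesis .
qed

section \<open>From uniform noise control to the error bound for all local averages\<close>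

theorem theorem4:
  fixes M :: "'w measure"
    and X :: "nat \<Rightarrow> 'w \<Rightarrow> 'a::euclidean_space"
    and Y :: "nat \<Rightarrow> 'w \<Rightarrow> real"
    and S :: "'a set"
    and g :: "'a \<Rightarrow> real"
    and V :: "'w \<Rightarrow> 'a \<Rightarrow> 'a set"
    and \<A> :: "'a set set"
    and n v :: nat
    and \<delta> \<sigma> L :: real
  assumes "n \<ge> 1"
    and "0 < \<delta>" and "\<delta> < 1/2"
    and "iid_sample M X Y n"
    and "\<And>i \<omega>. i \<le> n \<Longrightarrow> \<omega> \<in> space M \<Longrightarrow> X i \<omega> \<in> S"
    and "regression_function M (X 0) (Y 0) S g"
    and "cond_subgaussian M (sigma_gen M (X 0)) (\<lambda>\<omega>. Y 0 \<omega> - g (X 0 \<omega>)) (\<sigma>\<^sup>2)"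
    and "lipschitz_on L S g"
    and "\<And>\<omega>. \<omega> \<in> space M \<Longrightarrow> local_map S (V \<omega>)"
    and "\<And>\<omega> x. \<omega> \<in> space M \<Longrightarrow> x \<in> S \<Longrightarrow> V \<omega> x \<in> \<A>"
    and "has_vc_dim \<A> v"
    and "pattern_measurable (distr M (restrict_space borel S) (X 0)) n \<A>"
  shows "\<exists>E\<in>sets M. measure M E \<ge> 1 - 2 * \<delta> \<and>
           (\<forall>\<omega>\<in>E. \<forall>x\<in>S.
              ereal \<bar>local_average n (\<lambda>i. X i \<omega>) (\<lambda>i. Y i \<omega>) (V \<omega>) x - g x\<bar>
                \<le> error_bound n (\<lambda>i. X i \<omega>) \<sigma> v \<delta> g (V \<omega> x))"
proof -
  interpret prob_space M using assms(4) by (simp add: iid_sample_def)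
  define Q where "Q = (restrict_space borel S :: 'a measure)"
  define Z where "Z i \<omega> = (X i \<omega>, Y i \<omega>)" for i \<omega>
  define P where "P = distr M (Q \<Otimes>\<^sub>M borel) (Z 0)"
  \<comment> \<open>Only the observations are indexed; the generic pair, with index 0, enters
    through its law \<open>P\<close>.\<close>
  define J where "J = {1..n}"
  define e where "e z = snd z - g (fst z)" for z
  define \<Lambda> where "\<Lambda> = ln ((real n + 1) ^ v / \<delta>)"
  have J: "finite J" "J \<noteq> {}" "\<And>i. i \<in> J \<Longrightarrow> i \<le> n"
    using assms(1) by (auto simp: J_def)
  have Z: "Z i \<in> M \<rightarrow>\<^sub>M Q \<Otimes>\<^sub>M borel" if "i \<le> n" for i
    unfolding Z_def Q_def by (rule sample_in_subspace(1)[OF assms(4,5) that])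
  have indep: "indep_vars (\<lambda>_. Q \<Otimes>\<^sub>M borel) Z {0..n}"
    unfolding Z_def Q_def by (rule sample_in_subspace(2)[OF assms(4,5)])
  have law: "distr M (Q \<Otimes>\<^sub>M borel) (Z i) = P" if "i \<le> n" for i
    unfolding P_def Z_def Q_def by (rule sample_in_subspace(3)[OF assms(4,5) that])
  have g [measurable]: "g \<in> borel_measurable Q"
    using assms(6) by (simp add: regression_function_def Q_def)
  have fst_P [measurable]: "fst \<in> P \<rightarrow>\<^sub>M Q" unfolding P_def by simp
  have e_meas [measurable]: "e \<in> borel_measurable (Q \<Otimes>\<^sub>M borel)" unfolding e_def by measurable
  have X0: "X 0 \<in> M \<rightarrow>\<^sub>M Q"
    using measurable_compose[OF Z[of 0] measurable_fst] by (simp add: Z_def)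
  interpret noise: subgaussian_noise P Q fst e "\<sigma>\<^sup>2"
  proof (intro subgaussian_noise.intro subgaussian_noise_axioms.intro)
    show "prob_space P" unfolding P_def by (rule prob_space_distr[OF Z]) simp
    show "e \<in> borel_measurable P" by (simp add: P_def)
    fix h :: "'a \<Rightarrow> ennreal" and t :: real
    assume h [measurable]: "h \<in> borel_measurable Q"
    have "(\<integral>\<^sup>+z. h (fst z) * ennreal (exp (t * e z)) \<partial>P)
        = (\<integral>\<^sup>+\<omega>. h (X 0 \<omega>) * ennreal (exp (t * (Y 0 \<omega> - g (X 0 \<omega>)))) \<partial>M)"
      unfolding P_def by (subst nn_integral_distr[OF Z[of 0]]) (auto simp: Z_def e_def)
    also have "\<dots> \<le> ennreal (exp (t\<^sup>2 * \<sigma>\<^sup>2 / 2)) * (\<integral>\<^sup>+\<omega>. h (X 0 \<omega>) \<partial>M)"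
    proof (rule nn_integral_cond_subgaussian[OF assms(7)])
      show "X 0 \<in> borel_measurable M"
        using X0 unfolding Q_def by (rule measurable_restrict_space2_iff[THEN iffD1, THEN conjunct1])
    qed (use assms(5) h in \<open>auto simp: Q_def\<close>)
    also have "(\<integral>\<^sup>+\<omega>. h (X 0 \<omega>) \<partial>M) = (\<integral>\<^sup>+z. h (fst z) \<partial>P)"
      unfolding P_def by (subst nn_integral_distr[OF Z[of 0]]) (auto simp: Z_def)
    finally show "(\<integral>\<^sup>+z. h (fst z) * ennreal (exp (t * e z)) \<partial>P)
        \<le> ennreal (exp (t\<^sup>2 * \<sigma>\<^sup>2 / 2)) * (\<integral>\<^sup>+z. h (fst z) \<partial>P)" .
  qed (rule fst_P, rule zero_le_power2)
  have marg: "distr P Q fst = distr M Q (X 0)"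
    unfolding P_def by (subst distr_distr[OF _ Z[of 0]]) (auto simp: Z_def comp_def)
  \<comment> \<open>The event that some member of \<open>\<A>\<close> selects exactly the indices
    \<open>I\<close>.\<close>
  define C where "C I = {xs \<in> J \<rightarrow>\<^sub>E space Q. \<exists>A\<in>\<A>. \<forall>i\<in>J. xs i \<in> A \<longleftrightarrow> i \<in> I}" for I
  have C: "C I \<in> sets (completion (PiM J (\<lambda>_. distr P Q fst)))" if "I \<subseteq> J" for I
    using assms(12) that unfolding marg unfolding pattern_measurable_def C_def J_def Q_def by simp
  have count: "card {I. I \<subseteq> J \<and> xs \<in> C I} \<le> (n + 1) ^ v" for xs
  proof -
    let ?D = "{I. I \<subseteq> {1..n} \<and> (\<exists>A\<in>\<A>. \<forall>i\<in>{1..n}. xs i \<in> A \<longleftrightarrow> i \<in> I)}"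
    have "finite ?D" by (rule finite_subset[of _ "Pow {1..n}"]) auto
    moreover have "{I. I \<subseteq> J \<and> xs \<in> C I} \<subseteq> ?D" unfolding C_def J_def by blast
    ultimately have "card {I. I \<subseteq> J \<and> xs \<in> C I} \<le> card ?D" by (rule card_mono)
    also have "\<dots> \<le> (n + 1) ^ v" by (rule card_index_patterns_le[OF assms(11)])
    finally show ?thesis .
  qed
  have pow: "1 \<le> (real n + 1) ^ v" by simp
  with assms(3) have "\<delta> \<le> (real n + 1) ^ v" by linarith
  then have "1 \<le> (real n + 1) ^ v / \<delta>" using assms(2) by (simp add: le_divide_eq)
  \<comment> \<open>\<open>\<Lambda>\<close> is chosen so that the tail bound
    \<open>2 * exp (- \<Lambda>)\<close>, multiplied by the number of patterns, is exactly
    \<open>2 * \<delta>\<close>.\<close>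
  then have "0 \<le> \<Lambda>" and exp_\<Lambda>: "2 * exp (- \<Lambda>) * real ((n + 1) ^ v) = 2 * \<delta>"
    using assms(2) pow unfolding \<Lambda>_def by (simp_all add: exp_minus field_simps)
  obtain E where E: "E \<in> sets (PiM J (\<lambda>_. P))" "emeasure (PiM J (\<lambda>_. P)) E \<le> ennreal (2 * \<delta>)"
    and good: "\<And>z I. z \<in> space (PiM J (\<lambda>_. P)) - E \<Longrightarrow> I \<subseteq> J \<Longrightarrow> compose J fst z \<in> C I \<Longrightarrow>
      \<bar>\<Sum>i\<in>I. e (z i)\<bar> \<le> sqrt (2 * \<sigma>\<^sup>2 * real (card I) * \<Lambda>)"
    using noise.uniform_deviation[OF J(1) \<open>0 \<le> \<Lambda>\<close> C count] unfolding exp_\<Lambda> by blast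
  let ?z = "\<lambda>\<omega>. \<lambda>i\<in>J. Z i \<omega>"
  have sets_P: "sets (PiM J (\<lambda>_. P)) = sets (PiM J (\<lambda>_. Q \<Otimes>\<^sub>M borel))"
    by (intro sets_PiM_cong) (auto simp: P_def)
  have z: "?z \<in> M \<rightarrow>\<^sub>M PiM J (\<lambda>_. P)"
    unfolding measurable_cong_sets[OF refl sets_P] using Z J(3) by (intro measurable_restrict) auto
  \<comment> \<open>Independence and equal laws make the joint law of the observations the product
    law on which \<open>E\<close> was found.\<close>
  have "distr M (PiM J (\<lambda>_. Q \<Otimes>\<^sub>M borel)) ?z = PiM J (\<lambda>i. distr M (Q \<Otimes>\<^sub>M borel) (Z i))"
  proof (subst indep_vars_iff_distr_eq_PiM'[symmetric])
    show "indep_vars (\<lambda>_. Q \<Otimes>\<^sub>M borel) Z J"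
      using indep by (rule indep_vars_subset) (auto simp: J_def)
  qed (use J Z in auto)
  also have "\<dots> = PiM J (\<lambda>_. P)"
    using law J(3) by (intro PiM_cong) auto
  finally have joint: "distr M (PiM J (\<lambda>_. P)) ?z = PiM J (\<lambda>_. P)"
    using distr_cong[OF refl sets_P, of M ?z ?z] by simp
  \<comment> \<open>\<open>E\<close> was chosen without reference to \<open>V\<close>, so
    \<open>G\<close> is measurable through the sample alone and serves every \<open>x\<close>
    simultaneously.\<close>
  define G where "G = space M - (?z -` E \<inter> space M)"
  have bad: "?z -` E \<inter> space M \<in> sets M" using z E(1) by (rule measurable_sets)
  have "emeasure M (?z -` E \<inter> space M) = emeasure (PiM J (\<lambda>_. P)) E"
    using emeasure_distr[OF z E(1)] unfolding joint by simp
  then have "ennreal (prob (?z -` E \<inter> space M)) \<le> ennreal (2 * \<delta>)"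
    using E(2) by (simp only: emeasure_eq_measure)
  then have "prob (?z -` E \<inter> space M) \<le> 2 * \<delta>"
    using assms(2) by (subst (asm) ennreal_le_iff) linarith+
  then have "prob G \<ge> 1 - 2 * \<delta>"
    unfolding G_def prob_compl[OF bad] by simp
  moreover have "G \<in> sets M" unfolding G_def using bad by simp
  moreover have "ereal \<bar>local_average n (\<lambda>i. X i \<omega>) (\<lambda>i. Y i \<omega>) (V \<omega>) x - g x\<bar>
      \<le> error_bound n (\<lambda>i. X i \<omega>) \<sigma> v \<delta> g (V \<omega> x)" if "\<omega> \<in> G" "x \<in> S" for \<omega> x
  proof -
    let ?I = "{i\<in>{1..n}. X i \<omega> \<in> V \<omega> x}"
    have \<omega>: "\<omega> \<in> space M" and nE: "?z \<omega> \<notin> E" using that(1) by (auto simp: G_def)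
    have V: "x \<in> V \<omega> x" "V \<omega> x \<subseteq> S"
      using assms(9)[OF \<omega>] that(2) sets.sets_into_space[of "V \<omega> x" "restrict_space borel S"]
      by (auto simp: local_map_def space_restrict_space)
    \<comment> \<open>The random cell matters only through the index set \<open>?I\<close> it
      selects; as it belongs to \<open>\<A>\<close>, the projected sample lies in
      \<open>C ?I\<close>.\<close>
    have "\<forall>i\<in>J. compose J fst (?z \<omega>) i \<in> V \<omega> x \<longleftrightarrow> i \<in> ?I"
      by (auto simp: J_def compose_def Z_def)
    moreover have "compose J fst (?z \<omega>) \<in> J \<rightarrow>\<^sub>E space Q"
      using assms(5)[OF J(3) \<omega>] by (auto simp: compose_def Z_def Q_def space_restrict_space)
    ultimately have "compose J fst (?z \<omega>) \<in> C ?I"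
      unfolding C_def using assms(10)[OF \<omega> that(2)] by blast
    moreover have "?I \<subseteq> J" by (auto simp: J_def)
    moreover have "?z \<omega> \<in> space (PiM J (\<lambda>_. P)) - E"
      using measurable_space[OF z \<omega>] nE by blast
    ultimately have "\<bar>\<Sum>i\<in>?I. e (?z \<omega> i)\<bar> \<le> sqrt (2 * \<sigma>\<^sup>2 * real (card ?I) * \<Lambda>)"
      by (intro good)
    moreover have "(\<Sum>i\<in>?I. e (?z \<omega> i)) = (\<Sum>i\<in>?I. Y i \<omega> - g (X i \<omega>))"
      by (intro sum.cong) (auto simp: J_def e_def Z_def)
    ultimately show ?thesis
      using V lipschitz_on_subset[OF assms(8)] unfolding \<Lambda>_def
      by (intro local_average_error_le) auto
  qed
  ultimately show ?thesis by blast
qed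

end
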